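(* For a Puiseux monoid $M$ the following statements are equivalent. (1) $\widetilde{M} \cong (\mathbb{N}_0,+)$. (2) $M$ is finitely generated. (3) $\mathsf{d}(M^\bullet)$ is finite. (4) $M$ is isomorphic to a numerical monoid.
   Context: A Puiseux monoid is an additive submonoid of $\mathbb{Q}_{\ge 0}$. Write $\mathbb{N} = \{1,2,3,\dots\}$, $\mathbb{N}_0 = \mathbb{N} \cup \{0\}$, and $M^\bullet := M \setminus \{0\}$. The difference group of $M$ is $\mathrm{gp}(M) = \{x-y \mid x,y \in M\} \subseteq \mathbb{Q}$, and the root closure of $M$ is $\widetilde{M} := \{x \in \mathrm{gp}(M) \mid kx \in M \text{ for some } k \in \mathbb{N}\}$. A monoid is finitely generated if it can be generated by a finite set. For $q \in \mathbb{Q}\setminus\{0\}$, $\mathsf{d}(q) \in \mathbb{N}$ is the denominator of $q$ in lowest terms, and $\mathsf{d}(M^\bullet) = \{\mathsf{d}(q) \mid q \in M^\bullet\}$. A numerical monoid is a submonoid $N$ of $(\mathbb{N}_0,+)$ with $\mathbb{N}_0 \setminus N$ finite. Isomorphisms are monoid isomorphisms.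
   Formalization: The Puiseux monoid M is assumed nontrivial (M ≠ {0}); for M = {0} statements (2) and (3) hold while (1) and (4) fail, so the equivalence is false there. *)

theory Defs
  imports Complex_Main "HOL-Algebra.Group"
begin

text \<open>
  \<open>additive_on S\<close> is \<open>(S, +, 0)\<close> as a monoid of HOL-Algebra. The library's \<open>hom\<close> does not ask for
  preservation of the unit, but a bijective multiplicative map between monoids preserves it, so
  \<open>\<cong>\<close> between such structures is monoid isomorphism.
\<close>

definition additive_on :: "'a::comm_monoid_add set \<Rightarrow> 'a monoid" where
  "additive_on S = \<lparr>carrier = S, mult = (+), one = 0\<rparr>"

definition puiseux_monoid :: "rat set \<Rightarrow> bool" where
  "puiseux_monoid M \<longleftrightarrow> submonoid M (additive_on {q. 0 \<le> q})"

definition numerical_monoid :: "nat set \<Rightarrow> bool" where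
  "numerical_monoid N \<longleftrightarrow> submonoid N (additive_on UNIV) \<and> finite (UNIV - N)"

definition finitely_generated_monoid :: "('a, 'b) monoid_scheme \<Rightarrow> bool" where
  "finitely_generated_monoid G \<longleftrightarrow>
     (\<exists>A. finite A \<and> A \<subseteq> carrier G \<and> (\<lambda>H. submonoid H G) hull A = carrier G)"

definition difference_group :: "rat set \<Rightarrow> rat set" where
  "difference_group M = {x - y | x y. x \<in> M \<and> y \<in> M}"

definition root_closure :: "rat set \<Rightarrow> rat set" where
  "root_closure M = {x \<in> difference_group M. \<exists>k::nat. k \<ge> 1 \<and> of_nat k * x \<in> M}"

text \<open>\<open>quotient_of\<close> yields the fraction in lowest terms with positive denominator.\<close>

definition denominator :: "rat \<Rightarrow> nat" where
  "denominator q = nat (snd (quotient_of q))"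

end

theory Submission
  imports Defs
begin

text \<open>
  Everything is compared with the condition that \<open>M\<close> has a common denominator. An injective additive
  \<open>f : M \<rightarrow> \<nat>\<close> satisfies \<open>f y \<cdot> x = f x \<cdot> y\<close>, because any two elements of \<open>M\<close> are commensurable, so
  it forces a common denominator. Conversely, if \<open>M\<close> has a common denominator, then \<open>M\<close> is a rescaled
  submonoid of \<open>\<nat>\<close>. Dividing by its least positive difference \<open>g = (b + g) - b\<close> yields a submonoid
  containing two consecutive integers, hence all large ones; so \<open>M = N r\<close> for a numerical monoid \<open>N\<close>,
  and the root closure of \<open>N r\<close> is \<open>\<nat>\<^sub>0 r\<close>.
\<close>

section \<open>Additive submonoids and their isomorphisms\<close>

lemma submonoid_additive_on_iff:
  "submonoid H (additive_on S) \<longleftrightarrow> H \<subseteq> S \<and> 0 \<in> H \<and> (\<forall>x\<in>H. \<forall>y\<in>H. x + y \<in> H)"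
  by (auto simp: submonoid_def additive_on_def)

lemma additive_on_iso_iff:
  "additive_on S \<cong> additive_on T \<longleftrightarrow>
     (\<exists>f. bij_betw f S T \<and> (\<forall>x\<in>S. \<forall>y\<in>S. f (x + y) = f x + f y))"
  unfolding is_iso_def iso_def hom_def additive_on_def
  by (auto dest: bij_betw_imp_funcset)

lemma submonoid_additive_on_mult:
  fixes H :: "'a::semiring_1 set"
  assumes "submonoid H (additive_on S)" and "x \<in> H"
  shows "of_nat n * x \<in> H"
  using assms by (induction n) (auto simp: submonoid_additive_on_iff distrib_right)

section \<open>Denominators of nonnegative rationals\<close>

lemma nonneg_rat_cases:
  assumes "0 \<le> (q::rat)"
  obtains a b :: nat where "q = of_nat a / of_nat b" "b > 0" "denominator q = b" "coprime a b"
proof -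
  obtain i j where ij: "quotient_of q = (i, j)" by fastforce
  have q: "q = of_int i / of_int j" and j: "j > 0" and c: "coprime i j"
    using ij quotient_of_div quotient_of_denom_pos quotient_of_coprime by auto
  have i: "i \<ge> 0" using assms q j by (simp add: zero_le_divide_iff)
  show thesis
  proof (rule that[of "nat i" "nat j"])
    show "q = of_nat (nat i) / of_nat (nat j)" using q i j by simp
    show "denominator q = nat j" by (simp add: denominator_def ij)
    show "coprime (nat i) (nat j)" using c i j coprime_int_iff[of "nat i" "nat j"] by simp
  qed (use j in simp)
qed

lemma denominator_mult_in_Nats:
  assumes "0 \<le> q" shows "of_nat (denominator q) * q \<in> \<nat>" "denominator q > 0"
  using assms by (auto elim!: nonneg_rat_cases)

lemma denominator_dvd:
  assumes "0 \<le> q" and "of_nat D * q \<in> \<nat>"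
  shows "denominator q dvd D"
proof -
  obtain a b where q: "q = of_nat a / of_nat b" "b > 0" "denominator q = b" "coprime a b"
    using assms nonneg_rat_cases by blast
  obtain n where "of_nat D * q = of_nat n" using assms(2) by (auto elim: Nats_cases)
  then have "(of_nat (D * a) :: rat) = of_nat (n * b)" using q by (simp add: field_simps)
  then have "D * a = n * b" by (simp only: of_nat_eq_iff)
  then have "b dvd D * a" by simp
  then show ?thesis using q by (simp add: coprime_dvd_mult_left_iff coprime_commute)
qed

text \<open>The product of finitely many denominators is a common denominator; conversely, lowest
  terms make every denominator divide \<open>D\<close>, hence at most \<open>D\<close>.
  \<open>M\<close> is an arbitrary set here because a finite generating set is also a use
  case.\<close>

lemma finite_denominators_iff:
  assumes "\<And>q. q \<in> M \<Longrightarrow> 0 \<le> q"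
  shows "finite (denominator ` (M - {0})) \<longleftrightarrow> (\<exists>D>0. \<forall>q\<in>M. of_nat D * q \<in> \<nat>)"
proof
  assume fin: "finite (denominator ` (M - {0}))"
  define D where "D = \<Prod>(denominator ` (M - {0}))"
  have "D > 0" unfolding D_def
  proof (rule prod_pos)
    show "0 < d" if "d \<in> denominator ` (M - {0})" for d
      using that assms denominator_mult_in_Nats(2) by blast
  qed
  moreover have "of_nat D * q \<in> \<nat>" if q: "q \<in> M" for q
  proof (cases "q = 0")
    case False
    then have "denominator q dvd D" unfolding D_def using fin q by (intro dvd_prodI) auto
    then obtain k where "D = k * denominator q" by (metis dvdE mult.commute)
    then have "of_nat D * q = of_nat k * (of_nat (denominator q) * q)" by simp
    then show ?thesis using denominator_mult_in_Nats(1) assms q by (metis Nats_mult of_nat_in_Nats)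
  qed simp
  ultimately show "\<exists>D>0. \<forall>q\<in>M. of_nat D * q \<in> \<nat>" by blast
next
  assume "\<exists>D>0. \<forall>q\<in>M. of_nat D * q \<in> \<nat>"
  then obtain D where "D > 0" "\<forall>q\<in>M. of_nat D * q \<in> \<nat>" by blast
  then have "denominator ` (M - {0}) \<subseteq> {..D}"
    using denominator_dvd assms by (auto intro!: dvd_imp_le)
  then show "finite (denominator ` (M - {0}))" using finite_subset by blast
qed

section \<open>Additive embeddings into the natural numbers\<close>

lemma common_denominator_if_additive_inj:
  fixes f :: "rat \<Rightarrow> nat"
  assumes M: "puiseux_monoid M" "M \<noteq> {0}" and inj: "inj_on f M"
    and add: "\<And>x y. x \<in> M \<Longrightarrow> y \<in> M \<Longrightarrow> f (x + y) = f x + f y"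
  shows "\<exists>D>0. \<forall>q\<in>M. of_nat D * q \<in> \<nat>"
proof -
  have sub: "submonoid M (additive_on {q. 0 \<le> q})" using M by (simp add: puiseux_monoid_def)
  have nonneg: "0 \<le> x" if "x \<in> M" for x using sub that by (auto simp: submonoid_additive_on_iff)
  have zero: "0 \<in> M" using sub by (auto simp: submonoid_additive_on_iff)
  have f0: "f 0 = 0" using add[OF zero zero] by simp
  have mult: "f (of_nat n * x) = n * f x" if "x \<in> M" for n x
    using that by (induction n) (auto simp: f0 distrib_right add submonoid_additive_on_mult[OF sub])
  obtain y where y: "y \<in> M" "y \<noteq> 0" using M zero by blast
  \<comment> \<open>Injectivity enters here: \<open>f y\<close> must differ from
    \<open>f 0 = 0\<close>.\<close>
  have fy: "f y > 0" using inj_onD[OF inj, of y 0] y f0 zero by auto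
  obtain c d where cd: "y = of_nat c / of_nat d" "d > 0"
    using nonneg_rat_cases nonneg y by metis
  have c: "c > 0" using cd y by (cases c) auto
  \<comment> \<open>With \<open>y = c / d\<close>, the relation \<open>f y * x = f x * y\<close>
    becomes \<open>(f y * d) * x = f x * c\<close>, so \<open>f y * d\<close> clears the denominator
    of every \<open>x\<close>.\<close>
  have "of_nat (f y * d) * x \<in> \<nat>" if x: "x \<in> M" for x
  proof -
    obtain a b where ab: "x = of_nat a / of_nat b" "b > 0"
      using nonneg_rat_cases nonneg x by metis
    \<comment> \<open>Both sides equal \<open>a * c\<close>. This common multiple of
      \<open>x\<close> and \<open>y\<close> lets \<open>f\<close> compare them.\<close>
    have "of_nat (b * c) * x = of_nat (a * d) * y" using ab cd by simp
    then have "(b * c) * f x = (a * d) * f y" using mult x y by metis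
    then have "of_nat (b * c * f x) = (of_nat (a * d * f y) :: rat)" by simp
    moreover have "of_nat a = of_nat b * x" using ab by simp
    ultimately have "of_nat b * (of_nat (f y * d) * x) = of_nat b * of_nat (c * f x)"
      by (auto simp: algebra_simps)
    then have "of_nat (f y * d) * x = of_nat (c * f x)" using ab(2) by (simp only: mult_cancel_left) simp
    then show ?thesis by (metis of_nat_in_Nats)
  qed
  then show ?thesis using fy cd by (metis nat_0_less_mult_iff)
qed

section \<open>Submonoids of the natural numbers\<close>

lemma nat_submonoid_eq_multiples:
  assumes S: "submonoid S (additive_on (UNIV :: nat set))" and "S \<noteq> {0}"
  obtains g N where "g > 0" "numerical_monoid N" "S = (*) g ` N"
proof -
  have zero: "0 \<in> S" and add: "\<And>x y. x \<in> S \<Longrightarrow> y \<in> S \<Longrightarrow> x + y \<in> S"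
    using S by (auto simp: submonoid_additive_on_iff)
  have mult: "k * x \<in> S" if "x \<in> S" for k x
    using submonoid_additive_on_mult[OF S that, of k] by simp
  define P where "P d \<longleftrightarrow> d > 0 \<and> (\<exists>b\<in>S. b + d \<in> S)" for d
  obtain s where "s \<in> S" "s > 0" using assms(2) zero by auto
  then have "P s" using zero by (force simp: P_def)
  define g where "g = (LEAST d. P d)"
  have "P g" unfolding g_def using \<open>P s\<close> by (rule LeastI)
  then obtain b where g: "g > 0" and b: "b \<in> S" "b + g \<in> S" by (auto simp: P_def)
  have dvd: "g dvd s" if "s \<in> S" for s
  proof (rule ccontr)
    assume "\<not> g dvd s"
    then have t: "s mod g > 0" by (simp add: mod_greater_zero_iff_not_dvd)
    \<comment> \<open>So \<open>s mod g\<close> is again a difference of two elements of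
      \<open>S\<close>. If positive, it would be smaller than the least one,
      \<open>g\<close>.\<close>
    have "s div g * (b + g) + s mod g = s + s div g * b"
      using div_mult_mod_eq[of s g] unfolding distrib_left by linarith
    then have "P (s mod g)" unfolding P_def using t that b
      by (intro conjI bexI[of _ "s div g * (b + g)"]) (auto intro: add mult)
    then have "g \<le> s mod g" unfolding g_def by (rule Least_le)
    then show False using mod_less_divisor[OF g, of s] by linarith
  qed
  define N where "N = {n. g * n \<in> S}"
  have N: "submonoid N (additive_on UNIV)"
    by (auto simp: submonoid_additive_on_iff N_def zero add distrib_left)
  obtain c where c: "b = g * c" using dvd b by blast
  have cN: "c \<in> N" "c + 1 \<in> N" using b c by (auto simp: N_def add.commute)
  \<comment> \<open>Write \<open>n = q * c + t\<close> with \<open>t < c\<close>. The bound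
    \<open>c * c\<close> gives \<open>q \<ge> c > t\<close>, so \<open>t\<close> of the
    \<open>q\<close> summands \<open>c\<close> can be replaced by \<open>c + 1\<close> to absorb the
    remainder. For \<open>c = 0\<close>, \<open>N\<close> contains 1 and hence everything.\<close>
  have "n \<in> N" if n: "n \<ge> c * c" for n
  proof (cases "c = 0")
    case True
    then show ?thesis using submonoid_additive_on_mult[OF N, of 1 n] cN by simp
  next
    case False
    define q t where "q = n div c" and "t = n mod c"
    have "t < c" "c \<le> q" using False n div_le_mono[OF n, of c] by (auto simp: q_def t_def)
    then have "n = (q - t) * c + t * (c + 1)"
      by (simp add: q_def t_def diff_mult_distrib algebra_simps)
    moreover have "(q - t) * c \<in> N" "t * (c + 1) \<in> N"
      using submonoid_additive_on_mult[OF N] cN by (metis of_nat_id)+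
    ultimately show ?thesis using N by (auto simp: submonoid_additive_on_iff)
  qed
  then have "UNIV - N \<subseteq> {..<c * c}" using not_le by blast
  then have "numerical_monoid N" using N finite_subset by (auto simp: numerical_monoid_def)
  moreover have "S = (*) g ` N" using dvd by (auto simp: N_def elim!: dvdE)
  ultimately show thesis using that g by blast
qed

text \<open>\<open>K\<close> need not be the least such bound. Its positivity lets it serve as a
  multiplier in the root closure and as a decreasing step in the induction for finite
  generation.\<close>

lemma numerical_monoid_conductor:
  assumes "numerical_monoid N"
  obtains K where "K > 0" "\<And>n. n \<ge> K \<Longrightarrow> n \<in> N"
proof -
  obtain k where k: "\<forall>n\<in>UNIV - N. n < k"
    using assms finite_nat_set_iff_bounded unfolding numerical_monoid_def by blast
  show thesis
  proof (rule that[of "Suc k"])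
    show "n \<in> N" if "n \<ge> Suc k" for n using bspec[OF k, of n] that by auto
  qed simp
qed

section \<open>Puiseux monoids as multiples of numerical monoids\<close>

lemma puiseux_monoid_eq_numerical_multiples:
  assumes M: "puiseux_monoid M" "M \<noteq> {0}" and "D > 0" and D: "\<And>q. q \<in> M \<Longrightarrow> of_nat D * q \<in> \<nat>"
  obtains r N where "r > 0" "numerical_monoid N" "M = (\<lambda>n. of_nat n * r) ` N"
proof -
  have sub: "submonoid M (additive_on {q. 0 \<le> q})" using M by (simp add: puiseux_monoid_def)
  define S where "S = {n. of_nat n / of_nat D \<in> M}"
  have MS: "M = (\<lambda>n. of_nat n / of_nat D) ` S"
  proof
    show "M \<subseteq> (\<lambda>n. of_nat n / of_nat D) ` S"
    proof
      fix q assume q: "q \<in> M"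
      obtain n where "of_nat D * q = of_nat n" using D[OF q] by (auto elim: Nats_cases)
      then have "q = of_nat n / of_nat D" using \<open>D > 0\<close> by (simp add: field_simps)
      then show "q \<in> (\<lambda>n. of_nat n / of_nat D) ` S" using q by (auto simp: S_def)
    qed
  qed (auto simp: S_def)
  have "submonoid S (additive_on UNIV)"
    using sub by (auto simp: submonoid_additive_on_iff S_def add_divide_distrib)
  moreover have "S \<noteq> {0}" using MS M by auto
  ultimately obtain g N where g: "g > 0" "numerical_monoid N" "S = (*) g ` N"
    by (rule nat_submonoid_eq_multiples)
  show thesis
  \<comment> \<open>Clearing denominators turns \<open>M\<close> into \<open>S\<close>, the set of
    multiples of \<open>g\<close> by \<open>N\<close>; dividing by \<open>D\<close> again gives
    \<open>r = g / D\<close>.\<close>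
  proof (rule that[of "of_nat g / of_nat D" N])
    show "M = (\<lambda>n. of_nat n * (of_nat g / of_nat D)) ` N"
      unfolding MS g(3) image_image by (simp add: mult.commute)
  qed (use g \<open>D > 0\<close> in auto)
qed

lemma root_closure_numerical_multiples:
  assumes "r > 0" and N: "numerical_monoid N" and M: "M = (\<lambda>n. of_nat n * r) ` N"
  shows "root_closure M = range (\<lambda>n. of_nat n * r)"
proof
  show "root_closure M \<subseteq> range (\<lambda>n. of_nat n * r)"
  proof
    fix x assume "x \<in> root_closure M"
    then obtain a b k n :: nat where x: "x = of_nat a * r - of_nat b * r" 
      and k: "k \<ge> 1" "of_nat k * x = of_nat n * r"
      by (auto simp: root_closure_def difference_group_def M)
    \<comment> \<open>A multiple of \<open>x\<close> lies in \<open>M\<close>, so \<open>x\<close>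
      is nonnegative and the natural subtraction \<open>a - b\<close> does not truncate.\<close>
    have "0 \<le> of_nat k * x" using k assms(1) by simp
    then have "0 \<le> x" using k(1) zero_le_mult_iff[of "of_nat k" x] by auto
    then have "b \<le> a" using x assms(1) by simp
    then have "x = of_nat (a - b) * r" using x by (simp add: of_nat_diff algebra_simps)
    then show "x \<in> range (\<lambda>n. of_nat n * r)" by blast
  qed
  show "range (\<lambda>n. of_nat n * r) \<subseteq> root_closure M"
  proof clarify
    fix n :: nat
    obtain K where K: "K > 0" "\<And>n. n \<ge> K \<Longrightarrow> n \<in> N"
      using numerical_monoid_conductor[OF N] by blast
    have "of_nat n * r = of_nat (n + K) * r - of_nat K * r" by (simp add: algebra_simps)
    moreover have "of_nat (n + K) * r \<in> M" "of_nat K * r \<in> M"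
      unfolding M using K by (auto intro!: imageI simp del: of_nat_add)
    ultimately have "of_nat n * r \<in> difference_group M" unfolding difference_group_def by blast
    \<comment> \<open>The multiplier \<open>K\<close> works for all \<open>n\<close>: if
      \<open>n\<close> is positive then \<open>K * n \<ge> K\<close>, and \<open>n = 0\<close> gives
      0.\<close>
    moreover have "K * n \<in> N"
    proof (cases "n = 0")
      case True
      then show ?thesis using N by (auto simp: numerical_monoid_def submonoid_additive_on_iff)
    qed (use K in simp)
    then have "of_nat (K * n) * r \<in> M" using M by blast
    then have "of_nat K * (of_nat n * r) \<in> M" by (simp add: mult.assoc)
    then have "\<exists>k::nat. k \<ge> 1 \<and> of_nat k * (of_nat n * r) \<in> M"
      using K(1) by (intro exI[of _ K]) auto
    ultimately show "of_nat n * r \<in> root_closure M" by (simp add: root_closure_def)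
  qed
qed

lemma finitely_generated_numerical_multiples:
  assumes N: "numerical_monoid N" and M: "M = (\<lambda>n. of_nat n * r) ` N"
  shows "finitely_generated_monoid (additive_on (M :: 'a::semiring_1 set))"
proof -
  obtain K where K: "K > 0" "\<And>n. n \<ge> K \<Longrightarrow> n \<in> N"
      using numerical_monoid_conductor[OF N] by blast
  \<comment> \<open>The bound \<open>2 * K\<close> suffices: if \<open>n \<ge> 2 * K\<close>, then
    \<open>n = (n - K) + K\<close> with \<open>n - K \<ge> K\<close> still in \<open>N\<close> and
    smaller than \<open>n\<close>, while \<open>K\<close> itself lies below the bound.\<close>
  define A where "A = (\<lambda>n. of_nat n * r) ` (N \<inter> {..<2 * K})"
  have "finite A" "A \<subseteq> M" by (auto simp: A_def M)
  have "submonoid M (additive_on M)" using N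
    by (auto simp: numerical_monoid_def submonoid_additive_on_iff M distrib_right[symmetric]
        of_nat_add[symmetric] simp del: of_nat_add intro: image_eqI[of _ _ 0])
  moreover have "M \<subseteq> H" if "submonoid H (additive_on M)" "A \<subseteq> H" for H
  proof -
    have "of_nat n * r \<in> H" if "n \<in> N" for n using that
    proof (induction n rule: less_induct)
      case (less n)
      show ?case
      proof (cases "n < 2 * K")
        case True
        then show ?thesis using \<open>A \<subseteq> H\<close> less by (auto simp: A_def)
      next
        case False
        have "of_nat (n - K) * r \<in> H" using False K by (intro less.IH) auto
        moreover have "of_nat K * r \<in> H" using K \<open>A \<subseteq> H\<close> by (auto simp: A_def)
        ultimately have "of_nat (n - K) * r + of_nat K * r \<in> H"
          using \<open>submonoid H (additive_on M)\<close> by (simp add: submonoid_additive_on_iff)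
        then show ?thesis using False
          by (simp add: distrib_right[symmetric] of_nat_add[symmetric] del: of_nat_add)
      qed
    qed
    then show ?thesis by (auto simp: M)
  qed
  ultimately have "(\<lambda>H. submonoid H (additive_on M)) hull A = M"
    using \<open>A \<subseteq> M\<close> by (intro hull_unique)
  then show ?thesis using \<open>finite A\<close> \<open>A \<subseteq> M\<close>
    by (auto simp: finitely_generated_monoid_def additive_on_def)
qed

section \<open>Finite generation, root closure and isomorphisms\<close>

lemma common_denominator_if_finitely_generated:
  assumes M: "puiseux_monoid M" and fg: "finitely_generated_monoid (additive_on M)"
  shows "\<exists>D>0. \<forall>q\<in>M. of_nat D * q \<in> \<nat>"
proof -
  have sub: "submonoid M (additive_on {q. 0 \<le> q})" using M by (simp add: puiseux_monoid_def)
  obtain A where A: "finite A" "A \<subseteq> M" "(\<lambda>H. submonoid H (additive_on M)) hull A = M"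
    using fg by (auto simp: finitely_generated_monoid_def additive_on_def)
  have "\<And>q. q \<in> A \<Longrightarrow> 0 \<le> q" using A sub by (auto simp: submonoid_additive_on_iff)
  then obtain D where D: "D > 0" "\<forall>q\<in>A. of_nat D * q \<in> \<nat>"
    using finite_denominators_iff[of A] A(1) by auto
  \<comment> \<open>The elements cleared by \<open>D\<close> form a submonoid containing the
    generators, hence all of \<open>M\<close>.\<close>
  have "submonoid {q \<in> M. of_nat D * q \<in> \<nat>} (additive_on M)"
    using sub by (auto simp: submonoid_additive_on_iff distrib_left)
  then have "(\<lambda>H. submonoid H (additive_on M)) hull A \<subseteq> {q \<in> M. of_nat D * q \<in> \<nat>}"
    using A D by (intro hull_minimal) auto
  then show ?thesis using A D by blast
qed

lemma subset_root_closure: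
  assumes "puiseux_monoid M"
  shows "M \<subseteq> root_closure M"
proof
  fix x assume x: "x \<in> M"
  have "0 \<in> M" using assms by (simp add: puiseux_monoid_def submonoid_additive_on_iff)
  then have "x \<in> difference_group M" using x by (force simp: difference_group_def)
  then show "x \<in> root_closure M" using x by (auto simp: root_closure_def intro: exI[of _ 1])
qed

lemma additive_on_multiples_iso:
  assumes "(r::rat) > 0"
  shows "additive_on ((\<lambda>n. of_nat n * r) ` N) \<cong> additive_on N"
proof -
  \<comment> \<open>Division by \<open>r\<close> inverts \<open>n \<mapsto> n * r\<close>; on
    multiples of \<open>r\<close> the floor is exact and only changes the type.\<close>
  define f where "f q = nat \<lfloor>q / r\<rfloor>" for q
  have f: "f (of_nat n * r) = n" for n using assms by (simp add: f_def)
  have "bij_betw f ((\<lambda>n. of_nat n * r) ` N) N"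
    by (auto simp: bij_betw_def inj_on_def f image_image)
  moreover have "f (of_nat m * r + of_nat n * r) = m + n" for m n
    using f[of "m + n"] by (simp add: distrib_right)
  ultimately show ?thesis unfolding additive_on_iso_iff by (intro exI[of _ f]) (auto simp: f)
qed

text \<open>The trivial monoid must be excluded: it is finitely generated and has no nonzero
  denominators to bound, but it equals its root closure and is finite, so it is isomorphic to no
  numerical monoid.\<close>

theorem proposition3p8:
  fixes M :: "rat set"
  assumes "puiseux_monoid M"
    and "M \<noteq> {0}"
  shows "(additive_on (root_closure M) \<cong> additive_on (UNIV :: nat set)
            \<longleftrightarrow> finitely_generated_monoid (additive_on M))
       \<and> (finitely_generated_monoid (additive_on M) \<longleftrightarrow> finite (denominator ` (M - {0})))
       \<and> (finite (denominator ` (M - {0}))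
            \<longleftrightarrow> (\<exists>N. numerical_monoid N \<and> additive_on M \<cong> additive_on N))"
proof -
  let ?P = "\<exists>D>0. \<forall>q\<in>M. of_nat D * q \<in> \<nat>"
  have "\<And>q. q \<in> M \<Longrightarrow> 0 \<le> q"
    using assms(1) by (auto simp: puiseux_monoid_def submonoid_additive_on_iff)
  then have den: "finite (denominator ` (M - {0})) \<longleftrightarrow> ?P" by (rule finite_denominators_iff)
  \<comment> \<open>Taking \<open>T\<close> to be the root closure or \<open>M\<close> itself covers
    both isomorphism conditions, since the isomorphism restricts to an additive injection on
    \<open>M\<close>.\<close>
  have P_if_embedded: ?P if iso: "additive_on T \<cong> additive_on U" and sub: "M \<subseteq> T" for T and U :: "nat set"
  proof -
    obtain f where f: "bij_betw f T U" "\<forall>x\<in>T. \<forall>y\<in>T. f (x + y) = f x + f y"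
      using iso unfolding additive_on_iso_iff by blast
    then have "inj_on f M" using sub by (metis bij_betw_def inj_on_subset)
    then show ?P using common_denominator_if_additive_inj assms f(2) sub by (metis subsetD)
  qed
  have if_P: "additive_on (root_closure M) \<cong> additive_on (UNIV :: nat set)
      \<and> finitely_generated_monoid (additive_on M)
      \<and> (\<exists>N. numerical_monoid N \<and> additive_on M \<cong> additive_on N)" if P: ?P
  proof -
    obtain r N where "r > 0" "numerical_monoid N" "M = (\<lambda>n. of_nat n * r) ` N"
      using puiseux_monoid_eq_numerical_multiples[OF assms] P by metis
    then show ?thesis
      using root_closure_numerical_multiples finitely_generated_numerical_multiples
        additive_on_multiples_iso by metis
  qed
  show ?thesis
    using den if_P P_if_embedded[OF _ subset_root_closure[OF assms(1)]]
      P_if_embedded[OF _ order_refl] common_denominator_if_finitely_generated[OF assms(1)]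
    by blast
qed

end
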